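(* Let $p$ be a propositional variable. There is no formula $\phi\in\mathcal{L}_\blacktriangle$ that defines $\Box p$ on the class of all frames; likewise none on the class of all reflexive frames, of all symmetric frames, of all transitive frames, or of all Euclidean frames.
   Context: Formulas are built from a countable set $\mathsf{Var}$ of variables; $\mathcal{L}_\blacktriangle$ uses $\neg,\wedge,\vee,\blacktriangle$ and $\mathcal{L}_\Box$ uses $\neg,\wedge,\vee,\Box$. A frame is $\langle W,R\rangle$, $W\neq\varnothing$, $R\subseteq W^2$; a model is $\langle W,R,v^+,v^-\rangle$ with independent $v^+,v^-:\mathsf{Var}\to 2^W$; a pointed model is a model with a state. $w\vDash^+p$ iff $w\in v^+(p)$; $w\vDash^-p$ iff $w\in v^-(p)$; $\neg$ swaps $\vDash^+$ and $\vDash^-$; $\wedge$: true iff both true, false iff some false; $\vee$: true iff some true, false iff both false. $w\vDash^+\Box\phi$ iff every $R$-successor $w'$ of $w$ has $w'\vDash^+\phi$; $w\vDash^-\Box\phi$ iff some $R$-successor $w'$ has $w'\vDash^-\phi$. $w_0\vDash^+\blacktriangle\phi$ iff for all $R$-successors $w_1,w_2$ of $w_0$, ($w_1\vDash^+\phi\Rightarrow w_2\vDash^+\phi$) and ($w_1\vDash^-\phi\Rightarrow w_2\vDash^-\phi$), and every $R$-successor $w_1$ has $w_1\vDash^+\phi$ or $w_1\vDash^-\phi$. $w_0\vDash^-\blacktriangle\phi$ iff there are successors $w_1,w_2$ of $w_0$ with ($w_1\vDash^+\phi$, $w_2\nvDash^+\phi$) or ($w_1\vDash^-\phi$, $w_2\nvDash^-\phi$)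 or ($w_1\vDash^+\phi$, $w_2\vDash^-\phi$). A formula $\phi$ of one language defines a formula $\chi$ of another in a class $\mathbb{K}$ of frames iff for every $\mathfrak{F}\in\mathbb{K}$ and every pointed model $\langle\mathfrak{M},w\rangle$ on $\mathfrak{F}$: $\mathfrak{M},w\vDash^+\phi$ iff $\mathfrak{M},w\vDash^+\chi$, and $\mathfrak{M},w\vDash^-\phi$ iff $\mathfrak{M},w\vDash^-\chi$. *)

theory Defs
  imports Main "HOL-Library.Countable"
begin

datatype 'v tri_fm =
    TVar 'v
  | TNeg "'v tri_fm"
  | TConj "'v tri_fm" "'v tri_fm"
  | TDisj "'v tri_fm" "'v tri_fm"
  | Tri "'v tri_fm"

datatype 'v box_fm =
    BVar 'v
  | BNeg "'v box_fm"
  | BConj "'v box_fm" "'v box_fm"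
  | BDisj "'v box_fm" "'v box_fm"
  | Box "'v box_fm"

record 'w frame =
  worlds :: "'w set"
  acc :: "'w rel"

record ('w, 'v) model =
  frame_of :: "'w frame"
  vpos :: "'v \<Rightarrow> 'w set"
  vneg :: "'v \<Rightarrow> 'w set"

definition is_frame :: "'w frame \<Rightarrow> bool" where
  "is_frame F \<longleftrightarrow> worlds F \<noteq> {} \<and> acc F \<subseteq> worlds F \<times> worlds F"

definition model_on :: "'w frame \<Rightarrow> ('w, 'v) model \<Rightarrow> bool" where
  "model_on F M \<longleftrightarrow> frame_of M = F \<and>
     (\<forall>p. vpos M p \<subseteq> worlds F) \<and> (\<forall>p. vneg M p \<subseteq> worlds F)"

definition succs :: "('w, 'v) model \<Rightarrow> 'w \<Rightarrow> 'w set" where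
  "succs M w = acc (frame_of M) `` {w}"

fun tri_true :: "('w, 'v) model \<Rightarrow> 'w \<Rightarrow> 'v tri_fm \<Rightarrow> bool"
  and tri_false :: "('w, 'v) model \<Rightarrow> 'w \<Rightarrow> 'v tri_fm \<Rightarrow> bool" where
  "tri_true M w (TVar p) \<longleftrightarrow> w \<in> vpos M p"
| "tri_true M w (TNeg \<phi>) \<longleftrightarrow> tri_false M w \<phi>"
| "tri_true M w (TConj \<phi> \<psi>) \<longleftrightarrow> tri_true M w \<phi> \<and> tri_true M w \<psi>"
| "tri_true M w (TDisj \<phi> \<psi>) \<longleftrightarrow> tri_true M w \<phi> \<or> tri_true M w \<psi>"
| "tri_true M w (Tri \<phi>) \<longleftrightarrow>
     (\<forall>w1 \<in> succs M w. \<forall>w2 \<in> succs M w.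
        (tri_true M w1 \<phi> \<longrightarrow> tri_true M w2 \<phi>) \<and>
        (tri_false M w1 \<phi> \<longrightarrow> tri_false M w2 \<phi>)) \<and>
     (\<forall>w1 \<in> succs M w. tri_true M w1 \<phi> \<or> tri_false M w1 \<phi>)"
| "tri_false M w (TVar p) \<longleftrightarrow> w \<in> vneg M p"
| "tri_false M w (TNeg \<phi>) \<longleftrightarrow> tri_true M w \<phi>"
| "tri_false M w (TConj \<phi> \<psi>) \<longleftrightarrow> tri_false M w \<phi> \<or> tri_false M w \<psi>"
| "tri_false M w (TDisj \<phi> \<psi>) \<longleftrightarrow> tri_false M w \<phi> \<and> tri_false M w \<psi>"
| "tri_false M w (Tri \<phi>) \<longleftrightarrow>
     (\<exists>w1 \<in> succs M w. \<exists>w2 \<in> succs M w.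
        (tri_true M w1 \<phi> \<and> \<not> tri_true M w2 \<phi>) \<or>
        (tri_false M w1 \<phi> \<and> \<not> tri_false M w2 \<phi>) \<or>
        (tri_true M w1 \<phi> \<and> tri_false M w2 \<phi>))"

fun box_true :: "('w, 'v) model \<Rightarrow> 'w \<Rightarrow> 'v box_fm \<Rightarrow> bool"
  and box_false :: "('w, 'v) model \<Rightarrow> 'w \<Rightarrow> 'v box_fm \<Rightarrow> bool" where
  "box_true M w (BVar p) \<longleftrightarrow> w \<in> vpos M p"
| "box_true M w (BNeg \<phi>) \<longleftrightarrow> box_false M w \<phi>"
| "box_true M w (BConj \<phi> \<psi>) \<longleftrightarrow> box_true M w \<phi> \<and> box_true M w \<psi>"
| "box_true M w (BDisj \<phi> \<psi>) \<longleftrightarrow> box_true M w \<phi> \<or> box_true M w \<psi>"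
| "box_true M w (Box \<phi>) \<longleftrightarrow> (\<forall>w' \<in> succs M w. box_true M w' \<phi>)"
| "box_false M w (BVar p) \<longleftrightarrow> w \<in> vneg M p"
| "box_false M w (BNeg \<phi>) \<longleftrightarrow> box_true M w \<phi>"
| "box_false M w (BConj \<phi> \<psi>) \<longleftrightarrow> box_false M w \<phi> \<or> box_false M w \<psi>"
| "box_false M w (BDisj \<phi> \<psi>) \<longleftrightarrow> box_false M w \<phi> \<and> box_false M w \<psi>"
| "box_false M w (Box \<phi>) \<longleftrightarrow> (\<exists>w' \<in> succs M w. box_false M w' \<phi>)"

definition defines_in :: "'w frame set \<Rightarrow> 'v tri_fm \<Rightarrow> 'v box_fm \<Rightarrow> bool" where
  "defines_in K \<phi> \<chi> \<longleftrightarrow>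
     (\<forall>F \<in> K. \<forall>M. model_on F M \<longrightarrow> (\<forall>w \<in> worlds F.
        (tri_true M w \<phi> \<longleftrightarrow> box_true M w \<chi>) \<and>
        (tri_false M w \<phi> \<longleftrightarrow> box_false M w \<chi>)))"

text \<open>
  The classes below contain the frames whose worlds are drawn from the type \<open>'w\<close>.
  For infinite \<open>'w\<close>, undefinability over such frames is equivalent to undefinability over the
  class of frames of arbitrary cardinality: a larger class admits no more defining formulas, and
  conversely, by the downward Loewenheim-Skolem theorem, a counterexample to definability can be
  taken countable, since all frame conditions and truth clauses involved are first-order.
\<close>

definition all_frames :: "'w frame set" where
  "all_frames = {F. is_frame F}"

definition reflexive_frames :: "'w frame set" where
  "reflexive_frames = {F. is_frame F \<and> refl_on (worlds F) (acc F)}"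

definition symmetric_frames :: "'w frame set" where
  "symmetric_frames = {F. is_frame F \<and> sym (acc F)}"

definition transitive_frames :: "'w frame set" where
  "transitive_frames = {F. is_frame F \<and> trans (acc F)}"

definition euclidean_frames :: "'w frame set" where
  "euclidean_frames = {F. is_frame F \<and>
     (\<forall>x y z. (x, y) \<in> acc F \<and> (x, z) \<in> acc F \<longrightarrow> (y, z) \<in> acc F)}"

end

theory Submission
  imports Defs
begin

text \<open>
  A formula of the triangle language can take the value ``both'' or ``neither'' at a world only if
  a variable does so there, or some argument of a triangle has that value at all successors. Hence
  at a reflexive world where every variable is classical, every formula is classical. But
  \<open>\<box>p\<close> is both true and false at such a world as soon as \<open>p\<close> is true at all
  successors and both true and false at one of them. This already happens on a two-element cluster,
  whose frame lies in all five classes.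
\<close>

lemma tri_classical_at_reflexive_world:
  assumes "w \<in> succs M w" and "\<And>q. w \<in> vneg M q \<longleftrightarrow> w \<notin> vpos M q"
  shows "tri_false M w \<phi> \<longleftrightarrow> \<not> tri_true M w \<phi>"
proof (induction \<phi>)
  case (Tri \<phi>)
  \<comment> \<open>A triangle that is both or neither at \<open>w\<close> makes its argument so at
    every successor, hence at \<open>w\<close> itself, against the induction hypothesis.\<close>
  then show ?case using assms(1) unfolding tri_true.simps tri_false.simps by blast
qed (use assms(2) in auto)

text \<open>Keeping \<open>K\<close> arbitrary lets one countermodel serve all five classes.\<close>

lemma not_defines_Box_on_cluster:
  fixes a b :: 'w and \<phi> :: "'v tri_fm"
  assumes "a \<noteq> b" and "\<lparr>worlds = {a, b}, acc = {a, b} \<times> {a, b}\<rparr> \<in> K"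
  shows "\<not> defines_in K \<phi> (Box (BVar p))"
proof
  assume def: "defines_in K \<phi> (Box (BVar p))"
  define F where "F = \<lparr>worlds = {a, b}, acc = {a, b} \<times> {a, b}\<rparr>"
  \<comment> \<open>Every variable is true and not false at \<open>a\<close>, but both at
    \<open>b\<close>: \<open>a\<close> is classical yet sees a world that is not.\<close>
  define M :: "('w, 'v) model"
    where "M = \<lparr>frame_of = F, vpos = (\<lambda>_. {a, b}), vneg = (\<lambda>_. {b})\<rparr>"
  have succs_M: "succs M a = {a, b}"
    by (auto simp: succs_def M_def F_def)
  have "model_on F M" "a \<in> worlds F"
    by (auto simp: model_on_def M_def F_def)
  moreover have "box_true M a (Box (BVar p))" "box_false M a (Box (BVar p))"
    by (auto simp: succs_M) (auto simp: M_def)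
  ultimately have "tri_true M a \<phi>" "tri_false M a \<phi>"
    using def assms(2) unfolding defines_in_def F_def by blast+
  moreover have "tri_false M a \<phi> \<longleftrightarrow> \<not> tri_true M a \<phi>"
    by (rule tri_classical_at_reflexive_world) (use assms(1) in \<open>auto simp: succs_M, auto simp: M_def\<close>)
  ultimately show False by blast
qed

theorem theorem5:
  fixes p :: "'v :: countable"
  assumes "infinite (UNIV :: 'w set)"
  shows "\<not> (\<exists>\<phi> :: 'v tri_fm. defines_in (all_frames :: 'w frame set) \<phi> (Box (BVar p)))
    \<and> \<not> (\<exists>\<phi> :: 'v tri_fm. defines_in (reflexive_frames :: 'w frame set) \<phi> (Box (BVar p)))
    \<and> \<not> (\<exists>\<phi> :: 'v tri_fm. defines_in (symmetric_frames :: 'w frame set) \<phi> (Box (BVar p)))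
    \<and> \<not> (\<exists>\<phi> :: 'v tri_fm. defines_in (transitive_frames :: 'w frame set) \<phi> (Box (BVar p)))
    \<and> \<not> (\<exists>\<phi> :: 'v tri_fm. defines_in (euclidean_frames :: 'w frame set) \<phi> (Box (BVar p)))"
proof -
  obtain a b :: 'w where "a \<noteq> b"
    using ex_new_if_finite[OF assms, of "{undefined}"] by auto
  let ?F = "\<lparr>worlds = {a, b}, acc = {a, b} \<times> {a, b}\<rparr>"
  have "is_frame ?F"
    by (simp add: is_frame_def)
  then have "?F \<in> all_frames" "?F \<in> reflexive_frames" "?F \<in> symmetric_frames"
    "?F \<in> transitive_frames" "?F \<in> euclidean_frames"
    unfolding all_frames_def reflexive_frames_def symmetric_frames_def transitive_frames_def
      euclidean_frames_def
    by (auto simp: refl_on_def sym_def trans_def)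
  then show ?thesis
    by (simp add: not_defines_Box_on_cluster[OF \<open>a \<noteq> b\<close>])
qed

end
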